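(* Let $T$ and $T'$ be two labeled acute triangles in the Euclidean plane. Then $$L(T,T')=m(T,T').$$ Furthermore, there exists a minimal Lipschitz map between them, i.e. a label-preserving homeomorphism $f:T\to T'$ with $L(f)=\exp(L(T,T'))$.
   Context: A labeled triangle $T$ is a (non-degenerate, closed, filled) triangle in the Euclidean plane whose vertices are labeled $v_1,v_2,v_3$ so that the labeling induces the counter-clockwise orientation on the boundary. The edge opposite $v_i$ is $e_i$, with length $\|e_i\|$; the altitude from $v_i$ is $h_i$, with length $\|h_i\|$. Primed symbols $v_i',e_i',h_i'$ denote the corresponding objects for $T'$. A triangle is acute if all three angles are strictly less than $\pi/2$. A label-preserving homeomorphism $f:T\to T'$ is a homeomorphism with $f(v_i)=v_i'$ for $i=1,2,3$. Its Lipschitz constant is $L(f)=\sup_{x,y\in T,\,x\ne y}\frac{d_{euc}(f(x),f(y))}{d_{euc}(x,y)}$, where $d_{euc}$ is the Euclidean distance. Define $$L(T,T')=\log\big(\inf\{L(f): f:T\to T' \text{ a label-preserving homeomorphism}\}\big),$$ $$m(T,T')=\log\Big(\max\Big\{\tfrac{\|e_1'\|}{\|e_1\|},\tfrac{\|e_2'\|}{\|e_2\|},\tfrac{\|e_3'\|}{\|e_3\|},\tfrac{\|h_1'\|}{\|h_1\|},\tfrac{\|h_2'\|}{\|h_2\|},\tfrac{\|h_3'\|}{\|h_3\|}\Big\}\Big).$$ *)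

theory Defs
  imports "HOL-Analysis.Analysis"
begin

text \<open>
  A labeled triangle is given by its vertices, indexed by the three-element type \<^typ>\<open>3\<close>.
  Arithmetic on this type is modulo 3, so the numeral 3 denotes 0, and the two labels other
  than \<open>i\<close> are \<open>i + 1\<close> and \<open>i + 2\<close>.
\<close>

type_synonym vertices = "3 \<Rightarrow> real^2"

text \<open>
  The determinant is twice the signed area; it is positive iff going from the first to the
  second to the third vertex is a counter-clockwise turn.
\<close>

definition labeled_triangle :: "vertices \<Rightarrow> bool" where
  "labeled_triangle v \<longleftrightarrow>
     \<not> collinear {v 1, v 2, v 3} \<and> 0 < det (vector [v 2 - v 1, v 3 - v 1] :: real^2^2)"

definition filled_triangle :: "vertices \<Rightarrow> (real^2) set" where
  "filled_triangle v = convex hull {v 1, v 2, v 3}"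

definition edge_length :: "vertices \<Rightarrow> 3 \<Rightarrow> real" where
  "edge_length v i = dist (v (i + 1)) (v (i + 2))"

definition altitude_foot :: "vertices \<Rightarrow> 3 \<Rightarrow> real^2" where
  "altitude_foot v i = (THE p. p \<in> affine hull {v (i + 1), v (i + 2)} \<and>
                               orthogonal (v i - p) (v (i + 2) - v (i + 1)))"

definition altitude_length :: "vertices \<Rightarrow> 3 \<Rightarrow> real" where
  "altitude_length v i = dist (v i) (altitude_foot v i)"

definition vertex_angle :: "vertices \<Rightarrow> 3 \<Rightarrow> real" where
  "vertex_angle v i =
     arccos (((v (i + 1) - v i) \<bullet> (v (i + 2) - v i)) /
             (norm (v (i + 1) - v i) * norm (v (i + 2) - v i)))"

definition acute :: "vertices \<Rightarrow> bool" where
  "acute v \<longleftrightarrow> (\<forall>i. vertex_angle v i < pi / 2)"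

text \<open>Maps are total on the plane; only their values on the triangle matter.\<close>

definition label_preserving_homeo :: "vertices \<Rightarrow> vertices \<Rightarrow> (real^2 \<Rightarrow> real^2) \<Rightarrow> bool" where
  "label_preserving_homeo v v' f \<longleftrightarrow>
     (\<exists>g. homeomorphism (filled_triangle v) (filled_triangle v') f g) \<and> (\<forall>i. f (v i) = v' i)"

text \<open>The supremum is taken in \<^typ>\<open>ereal\<close> because a homeomorphism need not be Lipschitz.\<close>

definition lipschitz_constant :: "(real^2) set \<Rightarrow> (real^2 \<Rightarrow> real^2) \<Rightarrow> ereal" where
  "lipschitz_constant T f =
     (SUP (x, y) \<in> {(x, y). x \<in> T \<and> y \<in> T \<and> x \<noteq> y}. ereal (dist (f x) (f y) / dist x y))"

definition ereal_ln :: "ereal \<Rightarrow> ereal" where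
  "ereal_ln x =
     (case x of ereal r \<Rightarrow> if 0 < r then ereal (ln r) else - \<infinity> | PInfty \<Rightarrow> \<infinity> | MInfty \<Rightarrow> - \<infinity>)"

definition L_dist :: "vertices \<Rightarrow> vertices \<Rightarrow> ereal" where
  "L_dist v v' =
     ereal_ln (INF f \<in> {f. label_preserving_homeo v v' f}. lipschitz_constant (filled_triangle v) f)"

definition m_dist :: "vertices \<Rightarrow> vertices \<Rightarrow> real" where
  "m_dist v v' =
     ln (Max (range (\<lambda>i. edge_length v' i / edge_length v i) \<union>
              range (\<lambda>i. altitude_length v' i / altitude_length v i)))"

lemma altitude_foot_unique:
  assumes "labeled_triangle v"
  shows "\<exists>!p. p \<in> affine hull {v (i + 1), v (i + 2)} \<and>
              orthogonal (v i - p) (v (i + 2) - v (i + 1))"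
proof -
  define a b where "a = v (i + 1)" and "b = v (i + 2)"
  have "v 2 \<noteq> v 1" "v 3 \<noteq> v 1" "v 3 \<noteq> v 2"
    using assms by (auto simp: labeled_triangle_def insert_commute)
  moreover have "v 4 = v 1" "v 5 = v 2" by (rule arg_cong[where f = v], simp)+
  ultimately have "a \<noteq> b"
    using exhaust_3[of i] by (auto simp: a_def b_def)
  then have pos: "(b - a) \<bullet> (b - a) \<noteq> 0" by simp
  have hull: "p \<in> affine hull {a, b} \<longleftrightarrow> (\<exists>t. p = a + t *\<^sub>R (b - a))" for p
  proof
    assume "p \<in> affine hull {a, b}"
    then obtain s t where "p = s *\<^sub>R a + t *\<^sub>R b" "s + t = 1"
      by (auto simp: affine_hull_2)
    then have "p = (1 - t) *\<^sub>R a + t *\<^sub>R b" by (simp add: eq_diff_eq)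
    then show "\<exists>t. p = a + t *\<^sub>R (b - a)" by (auto simp: algebra_simps)
  next
    assume "\<exists>t. p = a + t *\<^sub>R (b - a)"
    then obtain t where "p = (1 - t) *\<^sub>R a + t *\<^sub>R b" by (auto simp: algebra_simps)
    then show "p \<in> affine hull {a, b}"
      unfolding affine_hull_2 by (intro CollectI exI[of _ "1 - t"] exI[of _ t]) simp
  qed
  have orth: "orthogonal (v i - (a + t *\<^sub>R (b - a))) (b - a) \<longleftrightarrow>
      t = (v i - a) \<bullet> (b - a) / ((b - a) \<bullet> (b - a))" for t
  proof -
    have "(v i - (a + t *\<^sub>R (b - a))) \<bullet> (b - a) = (v i - a) \<bullet> (b - a) - t * ((b - a) \<bullet> (b - a))"
      by (simp add: inner_diff_left inner_add_left)
    then show ?thesis using pos by (auto simp: orthogonal_def eq_divide_eq)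
  qed
  have "\<exists>!p. p \<in> affine hull {a, b} \<and> orthogonal (v i - p) (b - a)"
    using hull orth by metis
  then show ?thesis by (simp add: a_def b_def)
qed

end

theory Submission
  imports Defs
begin

text \<open>
  A label-preserving homeomorphism maps vertices to vertices and, by invariance of domain, edges to
  edges. In an acute triangle the foot of an altitude lies on the opposite edge, so the distance
  of its image from \<open>v\<^sub>i'\<close> is at least the altitude of the target triangle; hence no Lipschitz
  constant is below any of the six ratios.

  Conversely let \<open>M\<close> be the largest ratio. If it is attained by an altitude, then by Pythagoras the two
  pieces into which its foot cuts the edge are stretched by at most \<open>M\<close>, and the map that is
  affine on each of the two right triangles cut off by the altitude is \<open>M\<close>-Lipschitz. If \<open>M\<close> is attained by
  an edge, the altitude ratios show that the two angles at this edge do not increase; changing them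
  one at a time passes through an acute triangle, and each of the two steps is of the first kind, with
  factors \<open>M\<close> and \<open>1\<close>.
\<close>

subsection \<open>Triangles in the frame of an altitude\<close>

text \<open>The square of twice the area of the triangle.\<close>

definition gram :: "'a::real_inner \<Rightarrow> 'a \<Rightarrow> 'a \<Rightarrow> real" where
  "gram A B C = (norm (B - A))\<^sup>2 * (norm (C - A))\<^sup>2 - ((B - A) \<bullet> (C - A))\<^sup>2"

text \<open>Expanding both sides into inner products gives the same polynomial, so all three
  altitudes can be computed from one area.\<close>

lemma gram_rotate: "gram B C A = gram A B C"
  unfolding gram_def power2_norm_eq_inner
  by (simp add: inner_diff_left inner_diff_right inner_commute) (simp add: power2_eq_square algebra_simps)

text \<open>Cauchy-Schwarz is strict for vectors that are not parallel.\<close>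

lemma gram_pos:
  fixes A B C :: "'a::euclidean_space"
  assumes "\<not> collinear {A, B, C}"
  shows "0 < gram A B C"
proof -
  have "\<not> collinear {0, B - A, C - A}"
    using assms collinear_3[of B A C] by (simp add: insert_commute)
  then have "\<bar>(B - A) \<bullet> (C - A)\<bar> < norm (B - A) * norm (C - A)"
    using norm_cauchy_schwarz_equal[of "B - A" "C - A"] Cauchy_Schwarz_ineq2[of "B - A" "C - A"] by linarith
  then have "\<bar>(B - A) \<bullet> (C - A)\<bar>\<^sup>2 < (norm (B - A) * norm (C - A))\<^sup>2"
    by (intro power_strict_mono) auto
  then show ?thesis by (simp add: gram_def power_mult_distrib)
qed

text \<open>
  \<open>D\<close> is the foot of the altitude from \<open>A\<close>, which cuts the opposite edge into pieces of lengths
  \<open>a\<close> and \<open>b\<close>; \<open>a / h\<close> and \<open>b / h\<close> are the cotangents of the angles at \<open>B\<close> and \<open>C\<close>.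
\<close>

definition altitude_frame ::
    "'a::real_inner \<Rightarrow> 'a \<Rightarrow> 'a \<Rightarrow> 'a \<Rightarrow> 'a \<Rightarrow> 'a \<Rightarrow> real \<Rightarrow> real \<Rightarrow> real \<Rightarrow> bool" where
  "altitude_frame A B C D u n a b h \<longleftrightarrow>
     A = D + h *\<^sub>R n \<and> B = D - a *\<^sub>R u \<and> C = D + b *\<^sub>R u \<and>
     u \<bullet> u = 1 \<and> n \<bullet> n = 1 \<and> u \<bullet> n = 0 \<and> 0 < a \<and> 0 < b \<and> 0 < h"

text \<open>Acute angles at \<open>B\<close> and \<open>C\<close> put the orthogonal projection of
  \<open>A\<close> strictly between them, so both pieces \<open>a\<close> and \<open>b\<close> are
  positive.\<close>

lemma altitude_frame_exists:
  fixes A B C :: "'a::real_inner"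
  assumes g: "0 < gram A B C" and B: "0 < (A - B) \<bullet> (C - B)" and C: "0 < (A - C) \<bullet> (B - C)"
  obtains D u n a b h where "altitude_frame A B C D u n a b h"
proof -
  define l where "l = norm (C - B)"
  have "C \<noteq> B" using B by auto
  then have l: "0 < l" by (simp add: l_def)
  have ll: "l * l = (C - B) \<bullet> (C - B)" by (simp add: l_def dot_square_norm power2_eq_square)
  define u where "u = (1 / l) *\<^sub>R (C - B)"
  define a where "a = (A - B) \<bullet> u"
  define b where "b = (A - C) \<bullet> (- u)"
  define D where "D = B + a *\<^sub>R u"
  define h where "h = norm (A - D)"
  define n where "n = (1 / h) *\<^sub>R (A - D)"
  have lu: "C - B = l *\<^sub>R u" using l by (simp add: u_def)
  have uu: "u \<bullet> u = 1" using l by (simp add: u_def ll[symmetric])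
  have ab: "a + b = l"
  proof -
    have "a + b = (C - B) \<bullet> u" by (simp add: a_def b_def inner_diff_left)
    also have "\<dots> = l" unfolding lu using uu by simp
    finally show ?thesis .
  qed
  have a: "0 < a" using B l by (simp add: a_def u_def)
  have b: "0 < b" using C l
    by (simp add: b_def u_def) (simp add: divide_less_0_iff inner_diff_right)
  have hh: "h * h = (A - D) \<bullet> (A - D)" by (simp add: h_def dot_square_norm power2_eq_square)
  \<comment> \<open>Base times height: a vanishing \<open>h\<close> would make the area
    zero.\<close>
  have "gram B C A = l\<^sup>2 * (h * h)"
    unfolding hh gram_def D_def lu power2_norm_eq_inner diff_add_eq_diff_diff_swap diff_diff_eq[symmetric]
    by (simp add: inner_diff_left inner_diff_right inner_commute uu a_def)
       (simp add: power2_eq_square algebra_simps)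
  then have "h \<noteq> 0" using g gram_rotate[of B C A] by auto
  then have h: "0 < h" by (simp add: h_def)
  have nn: "n \<bullet> n = 1" using h by (simp add: n_def hh[symmetric])
  have un: "u \<bullet> n = 0"
    by (simp add: n_def D_def inner_diff_right inner_add_right a_def uu inner_commute)
  have "C = D + b *\<^sub>R u"
    using lu unfolding ab[symmetric] D_def by (simp add: algebra_simps)
  moreover have "A = D + h *\<^sub>R n" using h by (simp add: n_def)
  moreover have "B = D - a *\<^sub>R u" by (simp add: D_def)
  ultimately have "altitude_frame A B C D u n a b h"
    using a b h nn un uu by (simp add: altitude_frame_def)
  then show ?thesis by (rule that)
qed

text \<open>In the orthonormal coordinates \<open>(u, n)\<close> centred at \<open>D\<close>, the
  vertices are \<open>A = (0, h)\<close>, \<open>B = (-a, 0)\<close> and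
  \<open>C = (b, 0)\<close>.\<close>

lemma altitude_frame_metric:
  assumes "altitude_frame A B C D u n a b h"
  shows "(dist A B)\<^sup>2 = a\<^sup>2 + h\<^sup>2" "(dist A C)\<^sup>2 = b\<^sup>2 + h\<^sup>2" "dist B C = a + b"
    "gram A B C = ((a + b) * h)\<^sup>2" "(B - A) \<bullet> (C - A) = h\<^sup>2 - a * b"
    "(A - B) \<bullet> (C - B) = a * (a + b)" "(A - C) \<bullet> (B - C) = b * (a + b)"
proof -
  have frame: "u \<bullet> u = 1" "n \<bullet> n = 1" "u \<bullet> n = 0" "n \<bullet> u = 0"
    and diff: "A - B = a *\<^sub>R u + h *\<^sub>R n" "A - C = h *\<^sub>R n - b *\<^sub>R u" "C - B = (a + b) *\<^sub>R u"
    "B - A = - a *\<^sub>R u - h *\<^sub>R n" "C - A = b *\<^sub>R u - h *\<^sub>R n" "B - C = - (a + b) *\<^sub>R u"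
    and pos: "0 < a" "0 < b"
    using assms by (auto simp: altitude_frame_def inner_commute algebra_simps)
  note expand = inner_diff_left inner_diff_right inner_add_left inner_add_right frame
  show 1: "(dist A B)\<^sup>2 = a\<^sup>2 + h\<^sup>2" "(dist A C)\<^sup>2 = b\<^sup>2 + h\<^sup>2"
    unfolding dist_norm power2_norm_eq_inner diff
    by (simp_all add: expand) (simp_all add: power2_eq_square)
  show 2: "(B - A) \<bullet> (C - A) = h\<^sup>2 - a * b"
    "(A - B) \<bullet> (C - B) = a * (a + b)" "(A - C) \<bullet> (B - C) = b * (a + b)"
    unfolding diff by (simp_all add: expand power2_eq_square algebra_simps)
  show "gram A B C = ((a + b) * h)\<^sup>2"
    using 1 by (simp add: gram_def 2 dist_norm norm_minus_commute)
       (simp add: power2_eq_square algebra_simps)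
  have "norm u = 1" using frame(1) by (simp add: norm_eq_1)
  then show "dist B C = a + b"
    using pos by (simp add: dist_norm diff(6))
qed

text \<open>\<open>r\<close> is the barycentric weight of \<open>A\<close>; the slice at height
  \<open>r * h\<close> is the base shrunk towards the altitude by the factor
  \<open>1 - r\<close>.\<close>

lemma altitude_frame_hull:
  assumes "altitude_frame A B C D u n a b h"
  shows "convex hull {A, B, C} =
    {D + s *\<^sub>R u + (r * h) *\<^sub>R n | s r. 0 \<le> r \<and> - a * (1 - r) \<le> s \<and> s \<le> b * (1 - r)}" (is "_ = ?R")
proof
  have pos: "0 < a" "0 < b" "0 < h" and
    eq: "A = D + h *\<^sub>R n" "B = D - a *\<^sub>R u" "C = D + b *\<^sub>R u"
    using assms by (auto simp: altitude_frame_def)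
  have comb: "r *\<^sub>R A + \<beta> *\<^sub>R B + \<gamma> *\<^sub>R C = D + (\<gamma> * b - \<beta> * a) *\<^sub>R u + (r * h) *\<^sub>R n"
    if "r + \<beta> + \<gamma> = 1" for r \<beta> \<gamma>
  proof -
    have "r *\<^sub>R A + \<beta> *\<^sub>R B + \<gamma> *\<^sub>R C
        = (r + \<beta> + \<gamma>) *\<^sub>R D + (\<gamma> * b - \<beta> * a) *\<^sub>R u + (r * h) *\<^sub>R n"
      by (simp add: eq algebra_simps)
    then show ?thesis using that by simp
  qed
  show "convex hull {A, B, C} \<subseteq> ?R"
  proof
    fix x assume "x \<in> convex hull {A, B, C}"
    then obtain r \<beta> \<gamma> where x: "0 \<le> r" "0 \<le> \<beta>" "0 \<le> \<gamma>" "r + \<beta> + \<gamma> = 1"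
      "x = r *\<^sub>R A + \<beta> *\<^sub>R B + \<gamma> *\<^sub>R C"
      unfolding convex_hull_3 by auto
    have r: "1 - r = \<beta> + \<gamma>" using x by simp
    have "0 \<le> \<gamma> * (a + b)" "0 \<le> \<beta> * (a + b)" using pos x by auto
    then have "- a * (1 - r) \<le> \<gamma> * b - \<beta> * a" "\<gamma> * b - \<beta> * a \<le> b * (1 - r)"
      unfolding r by (auto simp: algebra_simps)
    then show "x \<in> ?R" using x comb[of r \<beta> \<gamma>] by blast
  qed
  show "?R \<subseteq> convex hull {A, B, C}"
  proof clarify
    fix s r assume sr: "0 \<le> r" "- a * (1 - r) \<le> s" "s \<le> b * (1 - r)"
    \<comment> \<open>These weights solve \<open>\<beta> + \<gamma> = 1 - r\<close> and
      \<open>\<gamma> * b - \<beta> * a = s\<close>.\<close>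
    define \<beta> where "\<beta> = (b * (1 - r) - s) / (a + b)"
    define \<gamma> where "\<gamma> = (s + a * (1 - r)) / (a + b)"
    have ab: "a + b \<noteq> 0" using pos by simp
    have "\<beta> + \<gamma> = ((a + b) * (1 - r)) / (a + b)"
      unfolding \<beta>_def \<gamma>_def add_divide_distrib[symmetric] by (simp add: algebra_simps)
    then have sum: "r + \<beta> + \<gamma> = 1" using ab by simp
    have "\<gamma> * b - \<beta> * a = ((a + b) * s) / (a + b)"
      unfolding \<beta>_def \<gamma>_def times_divide_eq_left diff_divide_distrib[symmetric] by (simp add: algebra_simps)
    then have "\<gamma> * b - \<beta> * a = s" using ab by simp
    moreover have "0 \<le> \<beta>" "0 \<le> \<gamma>"
      using sr pos by (auto simp: \<beta>_def \<gamma>_def)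
    ultimately show "D + s *\<^sub>R u + (r * h) *\<^sub>R n \<in> convex hull {A, B, C}"
      unfolding convex_hull_3 using comb[OF sum] sum sr(1)
      by (intro CollectI exI[of _ r] exI[of _ \<beta>] exI[of _ \<gamma>]) simp
  qed
qed

subsection \<open>Lipschitz homeomorphisms between triangles\<close>

text \<open>Piecewise linear with its kink at 0: slope \<open>p\<close> on the negative side,
  \<open>q\<close> on the positive side.\<close>

definition two_slope :: "real \<Rightarrow> real \<Rightarrow> real \<Rightarrow> real" where
  "two_slope p q s = p * min s 0 + q * max s 0"

lemma two_slope_lipschitz:
  assumes "0 \<le> p" "p \<le> M" "0 \<le> q" "q \<le> M"
  shows "\<bar>two_slope p q s - two_slope p q t\<bar> \<le> M * \<bar>s - t\<bar>"
proof -
  have *: "\<bar>two_slope p q s - two_slope p q t\<bar> \<le> M * \<bar>s - t\<bar>" if "t \<le> s" for s t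
  proof -
    have m: "min t 0 \<le> min s 0" "max t 0 \<le> max s 0" using that by auto
    have e: "two_slope p q s - two_slope p q t
        = p * (min s 0 - min t 0) + q * (max s 0 - max t 0)"
      by (simp add: two_slope_def algebra_simps)
    have "0 \<le> p * (min s 0 - min t 0)" "0 \<le> q * (max s 0 - max t 0)"
      using m assms by auto
    moreover have "p * (min s 0 - min t 0) \<le> M * (min s 0 - min t 0)"
      "q * (max s 0 - max t 0) \<le> M * (max s 0 - max t 0)"
      using m assms by (auto intro: mult_right_mono)
    moreover have "M * (min s 0 - min t 0) + M * (max s 0 - max t 0) = M * (s - t)"
      by (simp add: distrib_left[symmetric] min_def max_def)
    ultimately show ?thesis unfolding e using that by simp
  qed
  show ?thesis
    using *[of t s] *[of s t] by (cases "t \<le> s") (auto simp: abs_minus_commute)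
qed

lemma two_slope_inverse:
  assumes "0 < p" "0 < q"
  shows "two_slope (1 / p) (1 / q) (two_slope p q s) = s"
proof (cases "0 \<le> s")
  case True
  then have "0 \<le> q * s" using assms by simp
  with True assms show ?thesis by (simp add: two_slope_def)
next
  case False
  then have "p * s \<le> 0" using assms by (simp add: mult_le_0_iff)
  with False assms show ?thesis by (simp add: two_slope_def)
qed

lemma two_slope_range:
  assumes "0 < a" "0 < b" "0 < a'" "0 < b'" "- a * r \<le> s" "s \<le> b * r"
  shows "- a' * r \<le> two_slope (a' / a) (b' / b) s" "two_slope (a' / a) (b' / b) s \<le> b' * r"
proof -
  \<comment> \<open>The sign of \<open>r\<close> is not assumed; it follows because the interval
    containing \<open>s\<close> is nonempty.\<close>
  have "0 \<le> (a + b) * r" using assms by (simp add: algebra_simps)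
  then have r: "0 \<le> r" using assms by (simp add: zero_le_mult_iff)
  have 1: "- a * r \<le> min s 0" "max s 0 \<le> b * r" using assms r by auto
  have "(a' / a) * (- a * r) \<le> (a' / a) * min s 0" "(b' / b) * max s 0 \<le> (b' / b) * (b * r)"
    by (rule mult_left_mono[OF 1(1)], use assms in simp, rule mult_left_mono[OF 1(2)], use assms in simp)
  moreover have "(a' / a) * (- a * r) = - a' * r" "(b' / b) * (b * r) = b' * r"
    using assms by simp_all
  moreover have "0 \<le> (b' / b) * max s 0" "(a' / a) * min s 0 \<le> 0"
    using assms by (auto intro: mult_nonneg_nonpos simp del: times_divide_eq_left)
  ultimately show "- a' * r \<le> two_slope (a' / a) (b' / b) s" "two_slope (a' / a) (b' / b) s \<le> b' * r"
    unfolding two_slope_def by linarith+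
qed

text \<open>The two coordinates are treated separately, so the map is affine on each side of the
  line through the altitude and its inverse has the same form.\<close>

definition frame_map ::
    "'a::real_inner \<Rightarrow> 'a \<Rightarrow> 'a \<Rightarrow> 'a \<Rightarrow> 'a \<Rightarrow> 'a \<Rightarrow> real \<Rightarrow> real \<Rightarrow> real \<Rightarrow> 'a \<Rightarrow> 'a" where
  "frame_map D u n D' u' n' p q k x =
     D' + two_slope p q ((x - D) \<bullet> u) *\<^sub>R u' + (k * ((x - D) \<bullet> n)) *\<^sub>R n'"

lemma frame_map_frame:
  assumes "u \<bullet> u = 1" "n \<bullet> n = 1" "u \<bullet> n = 0"
  shows "frame_map D u n D' u' n' p q k (D + s *\<^sub>R u + t *\<^sub>R n) =
    D' + two_slope p q s *\<^sub>R u' + (k * t) *\<^sub>R n'"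
proof -
  have "n \<bullet> u = 0" using assms by (simp add: inner_commute)
  with assms show ?thesis by (simp add: frame_map_def add.assoc inner_add_left)
qed

lemma continuous_on_frame_map: "continuous_on S (frame_map D u n D' u' n' p q k)"
  unfolding frame_map_def two_slope_def by (intro continuous_intros)

text \<open>The vertices are separate arguments so that any of them can serve as the apex; neither
  labels nor orientation enter.\<close>

definition lipschitz_homeo ::
    "real \<Rightarrow> 'a::real_inner \<Rightarrow> 'a \<Rightarrow> 'a \<Rightarrow> 'a \<Rightarrow> 'a \<Rightarrow> 'a \<Rightarrow> bool" where
  "lipschitz_homeo M A B C A' B' C' \<longleftrightarrow>
     (\<exists>f g. homeomorphism (convex hull {A, B, C}) (convex hull {A', B', C'}) f g \<and>
        f A = A' \<and> f B = B' \<and> f C = C' \<and> M-lipschitz_on (convex hull {A, B, C}) f)"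

lemma lipschitz_homeo_rotate:
  "lipschitz_homeo M B C A B' C' A' \<Longrightarrow> lipschitz_homeo M A B C A' B' C'"
  unfolding lipschitz_homeo_def by (simp add: insert_commute) blast

lemma lipschitz_homeo_trans:
  assumes "lipschitz_homeo M A B C A' B' C'" "lipschitz_homeo N A' B' C' A'' B'' C''"
  shows "lipschitz_homeo (N * M) A B C A'' B'' C''"
proof -
  obtain f g where f: "homeomorphism (convex hull {A, B, C}) (convex hull {A', B', C'}) f g"
    "f A = A'" "f B = B'" "f C = C'" "M-lipschitz_on (convex hull {A, B, C}) f"
    using assms(1) unfolding lipschitz_homeo_def by blast
  obtain f' g' where f': "homeomorphism (convex hull {A', B', C'}) (convex hull {A'', B'', C''}) f' g'"
    "f' A' = A''" "f' B' = B''" "f' C' = C''" "N-lipschitz_on (convex hull {A', B', C'}) f'"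
    using assms(2) unfolding lipschitz_homeo_def by blast
  have "f ` (convex hull {A, B, C}) = convex hull {A', B', C'}"
    using f(1) by (simp add: homeomorphism_def)
  then have "(N * M)-lipschitz_on (convex hull {A, B, C}) (f' \<circ> f)"
    using lipschitz_on_compose[of M "convex hull {A, B, C}" f N f'] f f' by simp
  then show ?thesis
    unfolding lipschitz_homeo_def
    using homeomorphism_compose[OF f(1) f'(1)] f f'
    by (intro exI[of _ "f' \<circ> f"] exI[of _ "g \<circ> g'"]) simp
qed

text \<open>The slice with parameter \<open>r\<close> goes onto the slice with the same
  \<open>r\<close>, and reciprocal slopes give the inverse. Each coordinate is stretched by at most
  \<open>M\<close>, and the coordinates are orthogonal, so distances are too.\<close>

lemma lipschitz_homeo_frames:
  assumes fr: "altitude_frame A B C D u n a b h"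
    and fr': "altitude_frame A' B' C' D' u' n' a' b' h'"
    and le: "a' \<le> M * a" "b' \<le> M * b" "h' \<le> M * h"
  shows "lipschitz_homeo M A B C A' B' C'"
proof -
  have pos: "0 < a" "0 < b" "0 < h" "0 < a'" "0 < b'" "0 < h'"
    and on: "u \<bullet> u = 1" "n \<bullet> n = 1" "u \<bullet> n = 0"
    and on': "u' \<bullet> u' = 1" "n' \<bullet> n' = 1" "u' \<bullet> n' = 0"
    and eq: "A = D + h *\<^sub>R n" "B = D - a *\<^sub>R u" "C = D + b *\<^sub>R u"
    and eq': "A' = D' + h' *\<^sub>R n'" "B' = D' - a' *\<^sub>R u'" "C' = D' + b' *\<^sub>R u'"
    using fr fr' by (auto simp: altitude_frame_def)
  define f where "f = frame_map D u n D' u' n' (a' / a) (b' / b) (h' / h)"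
  define g where "g = frame_map D' u' n' D u n (a / a') (b / b') (h / h')"
  have f: "f (D + s *\<^sub>R u + t *\<^sub>R n) = D' + two_slope (a' / a) (b' / b) s *\<^sub>R u' + (h' / h * t) *\<^sub>R n'" for s t
    unfolding f_def by (rule frame_map_frame[OF on])
  have g: "g (D' + s *\<^sub>R u' + t *\<^sub>R n') = D + two_slope (a / a') (b / b') s *\<^sub>R u + (h / h' * t) *\<^sub>R n" for s t
    unfolding g_def by (rule frame_map_frame[OF on'])
  have fA: "f A = A'" "f B = B'" "f C = C'"
    using f[of 0 h] f[of "-a" 0] f[of b 0] pos by (simp_all add: eq eq' two_slope_def)
  note hull = altitude_frame_hull[OF fr] and hull' = altitude_frame_hull[OF fr']
  have homeo: "homeomorphism (convex hull {A, B, C}) (convex hull {A', B', C'}) f g"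
  proof (rule homeomorphismI)
    show "continuous_on (convex hull {A, B, C}) f" "continuous_on (convex hull {A', B', C'}) g"
      by (simp_all add: f_def g_def continuous_on_frame_map)
    show "f ` (convex hull {A, B, C}) \<subseteq> convex hull {A', B', C'}"
    proof clarify
      fix x assume "x \<in> convex hull {A, B, C}"
      then obtain s r where x: "x = D + s *\<^sub>R u + (r * h) *\<^sub>R n"
        and sr: "0 \<le> r" "- a * (1 - r) \<le> s" "s \<le> b * (1 - r)"
        unfolding hull by blast
      have "f x = D' + two_slope (a' / a) (b' / b) s *\<^sub>R u' + (r * h') *\<^sub>R n'"
        unfolding x f using pos by simp
      then show "f x \<in> convex hull {A', B', C'}"
        unfolding hull' using sr(1) two_slope_range[OF pos(1,2,4,5) sr(2,3)] by blast
    qed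
    show "g ` (convex hull {A', B', C'}) \<subseteq> convex hull {A, B, C}"
    proof clarify
      fix x assume "x \<in> convex hull {A', B', C'}"
      then obtain s r where x: "x = D' + s *\<^sub>R u' + (r * h') *\<^sub>R n'"
        and sr: "0 \<le> r" "- a' * (1 - r) \<le> s" "s \<le> b' * (1 - r)"
        unfolding hull' by blast
      have "g x = D + two_slope (a / a') (b / b') s *\<^sub>R u + (r * h) *\<^sub>R n"
        unfolding x g using pos by simp
      then show "g x \<in> convex hull {A, B, C}"
        unfolding hull using sr(1) two_slope_range[OF pos(4,5,1,2) sr(2,3)] by blast
    qed
    show "g (f x) = x" if "x \<in> convex hull {A, B, C}" for x
    proof -
      obtain s t where x: "x = D + s *\<^sub>R u + t *\<^sub>R n" using \<open>x \<in> _\<close> unfolding hull by blast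
      show ?thesis unfolding x f g using pos two_slope_inverse[of "a' / a" "b' / b" s] by simp
    qed
    show "f (g x) = x" if "x \<in> convex hull {A', B', C'}" for x
    proof -
      obtain s t where x: "x = D' + s *\<^sub>R u' + t *\<^sub>R n'" using \<open>x \<in> _\<close> unfolding hull' by blast
      show ?thesis unfolding x f g using pos two_slope_inverse[of "a / a'" "b / b'" s] by simp
    qed
  qed
  have "0 < M * a" using le pos by linarith
  then have M: "0 < M" using pos by (simp add: zero_less_mult_iff)
  have slopes: "a' / a \<le> M" "b' / b \<le> M" "h' / h \<le> M"
    using le pos by (simp_all add: divide_le_eq)
  have lip: "dist (f x) (f y) \<le> M * dist x y"
    if "x \<in> convex hull {A, B, C}" "y \<in> convex hull {A, B, C}" for x y
  proof -
    obtain s t where x: "x = D + s *\<^sub>R u + t *\<^sub>R n"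
      using \<open>x \<in> _\<close> unfolding hull by blast
    obtain s' t' where y: "y = D + s' *\<^sub>R u + t' *\<^sub>R n" using \<open>y \<in> _\<close> unfolding hull by blast
    \<comment> \<open>Pythagoras for an arbitrary orthonormal pair, to be used in both the source
      and the target frame.\<close>
    have d: "(dist (E + \<sigma> *\<^sub>R w + \<tau> *\<^sub>R m) (E + \<sigma>' *\<^sub>R w + \<tau>' *\<^sub>R m))\<^sup>2 = (\<sigma> - \<sigma>')\<^sup>2 + (\<tau> - \<tau>')\<^sup>2"
      if "w \<bullet> w = 1" "m \<bullet> m = 1" "w \<bullet> m = 0" for E w m :: 'a and \<sigma> \<sigma>' \<tau> \<tau>' :: real
      using that by (simp add: dist_norm power2_norm_eq_inner inner_diff_left inner_diff_right
          inner_add_left inner_add_right inner_commute) (simp add: power2_eq_square algebra_simps)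
    have "\<bar>two_slope (a' / a) (b' / b) s - two_slope (a' / a) (b' / b) s'\<bar>\<^sup>2 \<le> (M * \<bar>s - s'\<bar>)\<^sup>2"
      using two_slope_lipschitz[of "a' / a" M "b' / b" s s'] slopes pos
      by (intro power_mono) auto
    moreover have "\<bar>h' / h * t - h' / h * t'\<bar>\<^sup>2 \<le> (M * \<bar>t - t'\<bar>)\<^sup>2"
      unfolding right_diff_distrib[symmetric] abs_mult using slopes pos
      by (intro power_mono mult_right_mono) auto
    ultimately have "(dist (f x) (f y))\<^sup>2 \<le> (M * dist x y)\<^sup>2"
      unfolding x y f d[OF on'] power_mult_distrib d[OF on]
      by (simp add: power_mult_distrib distrib_left)
    then show ?thesis using M by (simp add: power2_le_iff_abs_le)
  qed
  have "M-lipschitz_on (convex hull {A, B, C}) f"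
    using lip M by (intro lipschitz_onI) auto
  with homeo fA show ?thesis unfolding lipschitz_homeo_def by blast
qed


section \<open>Altitudes from areas, and the case of an extremal altitude\<close>

text \<open>Twice the area over the base: this form avoids the foot, so altitudes from different
  vertices can be compared.\<close>

definition altitude :: "'a::real_inner \<Rightarrow> 'a \<Rightarrow> 'a \<Rightarrow> real" where
  "altitude A B C = sqrt (gram A B C) / dist B C"

lemma altitude_frame_altitude:
  assumes "altitude_frame A B C D u n a b h"
  shows "altitude A B C = h"
  using assms unfolding altitude_def altitude_frame_metric[OF assms]
  by (simp add: altitude_frame_def)

text \<open>Since the altitudes have ratio exactly \<open>M\<close>, subtracting their squares in
  Pythagoras turns the bounds on the two sides into bounds on the two pieces of the base.\<close>

lemma lipschitz_homeo_altitude: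
  assumes "0 < gram A B C" "0 < (A - B) \<bullet> (C - B)" "0 < (A - C) \<bullet> (B - C)"
    and "0 < gram A' B' C'" "0 < (A' - B') \<bullet> (C' - B')" "0 < (A' - C') \<bullet> (B' - C')"
    and alt: "altitude A' B' C' = M * altitude A B C"
    and le: "dist A' B' \<le> M * dist A B" "dist A' C' \<le> M * dist A C"
  shows "lipschitz_homeo M A B C A' B' C'"
proof -
  obtain D u n a b h where fr: "altitude_frame A B C D u n a b h"
    using altitude_frame_exists assms(1-3) by blast
  obtain D' u' n' a' b' h' where fr': "altitude_frame A' B' C' D' u' n' a' b' h'"
    using altitude_frame_exists assms(4-6) by blast
  have pos: "0 < a" "0 < b" "0 < h" "0 < h'"
    using fr fr' by (simp_all add: altitude_frame_def)
  have h: "h' = M * h"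
    using alt by (simp add: altitude_frame_altitude[OF fr] altitude_frame_altitude[OF fr'])
  with pos have M: "0 < M" by (simp add: zero_less_mult_iff)
  have "(dist A' B')\<^sup>2 \<le> (M * dist A B)\<^sup>2" "(dist A' C')\<^sup>2 \<le> (M * dist A C)\<^sup>2"
    using le by (auto intro: power_mono)
  then have "a'\<^sup>2 \<le> (M * a)\<^sup>2" "b'\<^sup>2 \<le> (M * b)\<^sup>2"
    unfolding power_mult_distrib altitude_frame_metric(1,2)[OF fr] altitude_frame_metric(1,2)[OF fr']
    by (simp_all add: h power_mult_distrib distrib_left)
  then have "a' \<le> M * a" "b' \<le> M * b"
    using M pos by (auto intro: power2_le_imp_le)
  then show ?thesis
    using lipschitz_homeo_frames[OF fr fr'] h by simp
qed

section \<open>Cotangents of the base angles, and the case of an extremal edge\<close>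

text \<open>For base angles with cotangents \<open>x\<close> and \<open>y\<close>, the base divided
  by the side at the first angle is \<open>(x + y) / sqrt (x^2 + 1)\<close>. It grows with
  \<open>x\<close> as long as the apex angle is at most a right angle, which is the condition
  \<open>x' * y \<le> 1\<close>.\<close>

lemma cot_ratio_mono:
  fixes x x' y :: real
  assumes "0 \<le> x" "x \<le> x'" "0 \<le> y" "x' * y \<le> 1"
  shows "(x + y)\<^sup>2 * (x'\<^sup>2 + 1) \<le> (x' + y)\<^sup>2 * (x\<^sup>2 + 1)"
proof -
  have "x * y \<le> x' * y" using assms by (intro mult_right_mono)
  then have "0 \<le> (x' - x) * (x * (1 - x' * y) + x' * (1 - x * y) + y * (1 - x * y) + y * (1 - x' * y))"
    using assms by (intro mult_nonneg_nonneg add_nonneg_nonneg) auto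
  also have "\<dots> = (x' + y)\<^sup>2 * (x\<^sup>2 + 1) - (x + y)\<^sup>2 * (x'\<^sup>2 + 1)"
    by (simp add: power2_eq_square algebra_simps)
  finally show ?thesis by simp
qed

text \<open>
  As \<open>altitude B C A = dist B C * sin \<gamma>\<close>, the hypothesis says that the angle at \<open>C\<close> does not
  increase; for acute angles this is a comparison of cotangents.
\<close>

lemma altitude_le_imp_cot_le:
  fixes M :: real
  assumes fr: "altitude_frame A B C D u n a b h"
    and fr': "altitude_frame A' B' C' D' u' n' a' b' h'"
    and base: "dist B' C' = M * dist B C"
  shows "altitude B' C' A' \<le> M * altitude B C A \<Longrightarrow> b / h \<le> b' / h'"
    and "altitude C' A' B' \<le> M * altitude C A B \<Longrightarrow> a / h \<le> a' / h'"
proof -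
  have pos: "0 < a" "0 < b" "0 < h" "0 < a'" "0 < b'" "0 < h'"
    using fr fr' by (simp_all add: altitude_frame_def)
  \<comment> \<open>Here \<open>c\<close> is the piece of the base at the vertex in question and
    \<open>p\<close> the side there, so \<open>h / p\<close> is the sine of the angle. Eliminating
    \<open>p\<close> by Pythagoras turns the comparison of sines into one of cotangents.\<close>
  have *: "c / h \<le> c' / h'"
    if "sqrt (((a' + b') * h')\<^sup>2) / p' \<le> M * (sqrt (((a + b) * h)\<^sup>2) / p)"
      "p\<^sup>2 = c\<^sup>2 + h\<^sup>2" "p'\<^sup>2 = c'\<^sup>2 + h'\<^sup>2" "0 \<le> p" "0 \<le> p'" "0 < c'" for c c' p p'
  proof -
    have "p \<noteq> 0" "p' \<noteq> 0" using that pos by (auto simp: sum_power2_eq_zero_iff)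
    with that have p: "0 < p" "0 < p'" by auto
    have "(a' + b') * (h' / p') \<le> (a' + b') * (h / p)"
      using that(1) base pos
      by (simp add: altitude_frame_metric(3)[OF fr] altitude_frame_metric(3)[OF fr'])
    then have "h' / p' \<le> h / p" by (rule mult_left_le_imp_le) (use pos in simp)
    then have "h' * p \<le> h * p'" using p by (simp add: field_simps)
    then have "(h' * p)\<^sup>2 \<le> (h * p')\<^sup>2" using pos p by (intro power_mono) auto
    then have "(h' * c)\<^sup>2 \<le> (h * c')\<^sup>2"
      unfolding power_mult_distrib that(2,3) by (simp add: algebra_simps)
    then have "h' * c \<le> h * c'" using pos that by (auto intro: power2_le_imp_le)
    then show ?thesis using pos by (simp add: field_simps)
  qed
  show "b / h \<le> b' / h'" if "altitude B' C' A' \<le> M * altitude B C A"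
    using that unfolding altitude_def gram_rotate[of B C A] gram_rotate[of B' C' A']
      altitude_frame_metric(4)[OF fr] altitude_frame_metric(4)[OF fr']
    using altitude_frame_metric(2)[OF fr] altitude_frame_metric(2)[OF fr'] pos
    by (intro *[of "dist C' A'" "dist C A"]) (simp_all add: dist_commute)
  show "a / h \<le> a' / h'" if "altitude C' A' B' \<le> M * altitude C A B"
    using that unfolding altitude_def gram_rotate[of A B C, symmetric] gram_rotate[of A' B' C', symmetric]
      altitude_frame_metric(4)[OF fr] altitude_frame_metric(4)[OF fr']
    using altitude_frame_metric(1)[OF fr] altitude_frame_metric(1)[OF fr'] pos
    by (intro *[of "dist A' B'" "dist A B"]) simp_all
qed

text \<open>\<open>k\<close> is an altitude, \<open>z\<close> the cotangent of a base angle and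
  \<open>d\<close> the side at that angle.\<close>

lemma cot_hypotenuse:
  fixes d k z :: real
  assumes "d\<^sup>2 = (z * k)\<^sup>2 + k\<^sup>2" "0 \<le> d" "0 \<le> k"
  shows "d = k * sqrt (z\<^sup>2 + 1)"
proof (rule power2_eq_imp_eq)
  show "d\<^sup>2 = (k * sqrt (z\<^sup>2 + 1))\<^sup>2"
    by (simp add: assms(1) power_mult_distrib algebra_simps)
qed (use assms in auto)

text \<open>The altitude bounds say that the cotangents at \<open>B\<close> and \<open>C\<close> do
  not decrease. The map factors through a triangle on the base \<open>B' C'\<close> that has the new
  angle at \<open>B'\<close> and still the old one at \<open>C'\<close>.\<close>

lemma lipschitz_homeo_edge:
  assumes gram: "0 < gram A B C" "0 < gram A' B' C'"
    and acute: "0 < (B - A) \<bullet> (C - A)" "0 < (A - B) \<bullet> (C - B)" "0 < (A - C) \<bullet> (B - C)"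
    and acute': "0 < (B' - A') \<bullet> (C' - A')" "0 < (A' - B') \<bullet> (C' - B')" "0 < (A' - C') \<bullet> (B' - C')"
    and base: "dist B' C' = M * dist B C"
    and alt: "altitude B' C' A' \<le> M * altitude B C A" "altitude C' A' B' \<le> M * altitude C A B"
  shows "lipschitz_homeo M A B C A' B' C'"
proof -
  obtain D u n a b h where fr: "altitude_frame A B C D u n a b h"
    using altitude_frame_exists gram(1) acute(2,3) by blast
  obtain D' u' n' a' b' h' where fr': "altitude_frame A' B' C' D' u' n' a' b' h'"
    using altitude_frame_exists gram(2) acute'(2,3) by blast
  define x y x' y' where "x = a / h" and "y = b / h" and "x' = a' / h'" and "y' = b' / h'"
  have pos: "0 < a" "0 < b" "0 < h" "0 < a'" "0 < b'" "0 < h'"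
    using fr fr' by (simp_all add: altitude_frame_def)
  then have pos_cot: "0 < x" "0 < y" "0 < x'" "0 < y'"
    by (simp_all add: x_def y_def x'_def y'_def)
  have sub: "a = x * h" "b = y * h" "a' = x' * h'" "b' = y' * h'"
    using pos by (simp_all add: x_def y_def x'_def y'_def)
  note m = altitude_frame_metric[OF fr, unfolded sub] and m' = altitude_frame_metric[OF fr', unfolded sub]
  have le: "x \<le> x'" "y \<le> y'"
    unfolding x_def y_def x'_def y'_def
    by (rule altitude_le_imp_cot_le(2)[OF fr fr' base alt(2)], rule altitude_le_imp_cot_le(1)[OF fr fr' base alt(1)])
  \<comment> \<open>The right-hand side is the inner product at \<open>A'\<close>. The resulting
    \<open>x' * y < 1\<close> is what makes the intermediate triangle acute at its apex.\<close>
  have "0 < h'\<^sup>2 * (1 - x' * y')" using acute'(1) m'(5) by (simp add: power2_eq_square algebra_simps)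
  then have xy': "x' * y' < 1" by (simp add: zero_less_mult_iff)
  moreover have "x' * y \<le> x' * y'" using le pos_cot by simp
  ultimately have xy: "x' * y < 1" by simp
  \<comment> \<open>A triangle with cotangents \<open>x'\<close> and \<open>y\<close> on the base
    \<open>B' C'\<close> has altitude \<open>t * h'\<close>, because
    \<open>t * (x' + y) = x' + y'\<close>.\<close>
  define t where "t = (x' + y') / (x' + y)"
  have t: "1 \<le> t" using le pos_cot by (simp add: t_def)
  have tt: "t * (x' + y) = x' + y'" using pos_cot by (simp add: t_def)
  have M: "M * ((x + y) * h) = (x' + y') * h'"
    using base m(3) m'(3) by (simp add: algebra_simps)
  txt \<open>
    \<open>Q\<close> is the point on the ray from \<open>B'\<close> through \<open>A'\<close> at which the angle at \<open>C'\<close> becomes that of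
    \<open>A B C\<close>. The altitude from \<open>B\<close> is scaled by exactly \<open>M\<close> from \<open>A B C\<close> to \<open>Q B' C'\<close>, and the altitude
    from \<open>C'\<close> is common to \<open>Q B' C'\<close> and \<open>A' B' C'\<close>, so that each step is an instance of
    \<open>lipschitz_homeo_altitude\<close>.
  \<close>
  define Q where "Q = B' + t *\<^sub>R (A' - B')"
  \<comment> \<open>The line through \<open>B'\<close> and \<open>A'\<close> is kept, so raising the
    apex from height \<open>h'\<close> to \<open>t * h'\<close> moves the foot by
    \<open>(t - 1) * (x' * h')\<close>.\<close>
  have frQ: "altitude_frame Q B' C' (D' + ((t - 1) * (x' * h')) *\<^sub>R u') u' n'
      (x' * (t * h')) (y * (t * h')) (t * h')"
  proof -
    have "C' = D' + (y' * h') *\<^sub>R u'" using fr' by (simp add: altitude_frame_def sub)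
    moreover have "y' = (t - 1) * x' + t * y" using tt by (simp add: algebra_simps)
    ultimately have "C' = D' + ((t - 1) * (x' * h')) *\<^sub>R u' + (y * (t * h')) *\<^sub>R u'"
      by (simp add: algebra_simps)
    moreover have B': "B' = D' - (x' * h') *\<^sub>R u'" and "A' - B' = (x' * h') *\<^sub>R u' + h' *\<^sub>R n'"
      using fr' by (simp_all add: altitude_frame_def sub)
    then have "Q = D' + ((t - 1) * (x' * h')) *\<^sub>R u' + (t * h') *\<^sub>R n'"
      unfolding Q_def by (simp add: algebra_simps)
    moreover have "B' = D' + ((t - 1) * (x' * h')) *\<^sub>R u' - (x' * (t * h')) *\<^sub>R u'"
      unfolding B' by (simp add: algebra_simps)
    ultimately show ?thesis
      using fr' t pos_cot pos by (simp add: altitude_frame_def)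
  qed
  note mQ = altitude_frame_metric[OF frQ]
  have base_len: "x' * (t * h') + y * (t * h') = (x' + y') * h'"
    unfolding tt[symmetric] by (simp add: algebra_simps)
  have angle_Q: "0 < (B' - Q) \<bullet> (C' - Q)"
  proof -
    have "0 < (t * h')\<^sup>2 * (1 - x' * y)" using xy t pos by simp
    then show ?thesis unfolding mQ(5) by (simp add: power2_eq_square algebra_simps)
  qed
  have gram_Q: "0 < gram Q B' C'" unfolding mQ(4) base_len using t pos pos_cot by simp
  have angle_QB: "0 < (Q - B') \<bullet> (C' - B')" and angle_QC: "0 < (Q - C') \<bullet> (B' - C')"
    unfolding mQ(6,7) using t pos pos_cot by (simp_all add: add_pos_pos)
  have dAC: "dist A C = h * sqrt (y\<^sup>2 + 1)"
    by (rule cot_hypotenuse[OF m(2)]) (use pos t in auto)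
  have dQC: "dist Q C' = t * h' * sqrt (y\<^sup>2 + 1)"
    by (rule cot_hypotenuse[OF mQ(2)]) (use pos t in auto)
  have dAB: "dist A B = h * sqrt (x\<^sup>2 + 1)"
    by (rule cot_hypotenuse[OF m(1)]) (use pos t in auto)
  have dAB': "dist A' B' = h' * sqrt (x'\<^sup>2 + 1)"
    by (rule cot_hypotenuse[OF m'(1)]) (use pos t in auto)
  have dQB: "dist Q B' = t * h' * sqrt (x'\<^sup>2 + 1)"
    by (rule cot_hypotenuse[OF mQ(1)]) (use pos t in auto)
  have "lipschitz_homeo M B C A B' C' Q"
  proof (rule lipschitz_homeo_altitude)
    show "0 < gram B C A" "0 < gram B' C' Q"
      using gram gram_Q by (simp_all add: gram_rotate[of B C A] gram_rotate[of B' C' Q])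
    show "0 < (B - C) \<bullet> (A - C)" "0 < (B - A) \<bullet> (C - A)"
      "0 < (B' - C') \<bullet> (Q - C')" "0 < (B' - Q) \<bullet> (C' - Q)"
      using acute angle_Q angle_QC by (simp_all add: inner_commute)
    have "altitude B' C' Q = ((x' + y') * h') * (t * h') / (t * h' * sqrt (y\<^sup>2 + 1))"
      unfolding altitude_def gram_rotate[of B' C' Q] mQ(4) base_len dist_commute[of C'] dQC using t pos pos_cot by simp
    also have "\<dots> = M * ((x + y) * h) / sqrt (y\<^sup>2 + 1)"
      unfolding M using t pos by simp
    also have "\<dots> = M * (((x + y) * h) * h / (h * sqrt (y\<^sup>2 + 1)))"
      using pos by simp
    also have "\<dots> = M * altitude B C A"
      unfolding altitude_def gram_rotate[of B C A] m(4) dist_commute[of C] dAC using pos pos_cot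
      by (simp add: distrib_right)
    finally show "altitude B' C' Q = M * altitude B C A" .
    show "dist B' C' \<le> M * dist B C" using base by simp
    \<comment> \<open>Both triangles have cotangent \<open>y\<close> at the end \<open>C\<close> or
      \<open>C'\<close> of the base, so \<open>cot_ratio_mono\<close> compares the quotients of base
      and side; the bases have ratio \<open>M\<close>.\<close>
    show "dist B' Q \<le> M * dist B A"
    proof -
      have "(x + y)\<^sup>2 * (x'\<^sup>2 + 1) \<le> (x' + y)\<^sup>2 * (x\<^sup>2 + 1)"
        using cot_ratio_mono le xy pos_cot by simp
      then have "sqrt ((x + y)\<^sup>2 * (x'\<^sup>2 + 1)) \<le> sqrt ((x' + y)\<^sup>2 * (x\<^sup>2 + 1))"
        by simp
      then have c: "(x + y) * sqrt (x'\<^sup>2 + 1) \<le> (x' + y) * sqrt (x\<^sup>2 + 1)"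
        using pos_cot by (simp add: real_sqrt_mult)
      have "(x + y) * dist Q B' = t * h' * ((x + y) * sqrt (x'\<^sup>2 + 1))" by (simp add: dQB)
      also have "\<dots> \<le> t * h' * ((x' + y) * sqrt (x\<^sup>2 + 1))"
        using c t pos by (intro mult_left_mono) auto
      also have "\<dots> = (t * (x' + y)) * h' * sqrt (x\<^sup>2 + 1)" by simp
      also have "\<dots> = (x + y) * (M * dist A B)" unfolding tt M[symmetric] dAB by simp
      finally show ?thesis using pos_cot by (simp add: dist_commute)
    qed
  qed
  then have "lipschitz_homeo M A B C Q B' C'" by (rule lipschitz_homeo_rotate)
  moreover have "lipschitz_homeo 1 C' Q B' C' A' B'"
  proof (rule lipschitz_homeo_altitude)
    show "0 < gram C' Q B'" "0 < gram C' A' B'"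
      using gram gram_Q
      by (simp_all add: gram_rotate[of Q B' C', symmetric] gram_rotate[of A' B' C', symmetric])
    show "0 < (C' - Q) \<bullet> (B' - Q)" "0 < (C' - B') \<bullet> (Q - B')"
      "0 < (C' - A') \<bullet> (B' - A')" "0 < (C' - B') \<bullet> (A' - B')"
      using acute' angle_Q angle_QB by (simp_all add: inner_commute)
    have "altitude C' A' B' = ((x' + y') * h') * h' / (h' * sqrt (x'\<^sup>2 + 1))"
      unfolding altitude_def gram_rotate[of A' B' C', symmetric] m'(4) dAB' using pos pos_cot
      by (simp add: distrib_right)
    also have "\<dots> = ((x' + y') * h') * (t * h') / (t * h' * sqrt (x'\<^sup>2 + 1))"
      using t pos by simp
    also have "\<dots> = altitude C' Q B'"
      unfolding altitude_def gram_rotate[of Q B' C', symmetric] mQ(4) base_len dQB using t pos pos_cot by simp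
    finally show "altitude C' A' B' = 1 * altitude C' Q B'" by simp
    show "dist C' B' \<le> 1 * dist C' B'" by simp
    \<comment> \<open>As the angle at \<open>A'\<close> is acute, moving from \<open>A'\<close> away
      from \<open>B'\<close> along their line leads away from \<open>C'\<close>.\<close>
    have "(dist A' C')\<^sup>2 \<le> (dist Q C')\<^sup>2"
    proof -
      have "Q - C' = (A' - C') + (t - 1) *\<^sub>R (A' - B')" by (simp add: Q_def algebra_simps)
      moreover have "(norm (w + s *\<^sub>R z))\<^sup>2 = (norm w)\<^sup>2 + 2 * s * (z \<bullet> w) + (s * norm z)\<^sup>2"
        for w z :: 'a and s
        unfolding power2_norm_eq_inner power_mult_distrib
        by (simp add: inner_add_left inner_add_right inner_commute power2_eq_square)
      ultimately have "(dist Q C')\<^sup>2 = (dist A' C')\<^sup>2 + 2 * (t - 1) * ((A' - B') \<bullet> (A' - C'))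
          + ((t - 1) * dist A' B')\<^sup>2"
        by (simp only: dist_norm)
      moreover have "(A' - B') \<bullet> (A' - C') = (B' - A') \<bullet> (C' - A')"
        by (simp add: inner_diff_left inner_diff_right)
      ultimately show ?thesis using acute'(1) t by simp
    qed
    then show "dist C' A' \<le> 1 * dist C' Q" by (simp add: dist_commute power2_le_iff_abs_le)
  qed
  then have "lipschitz_homeo 1 Q B' C' A' B' C'" by (intro lipschitz_homeo_rotate[of 1 B'] lipschitz_homeo_rotate[of 1 C'])
  ultimately show ?thesis using lipschitz_homeo_trans by fastforce
qed

subsection \<open>Homeomorphisms map edges to edges\<close>

lemma frontier_triangle:
  fixes A B C :: "'a::euclidean_space"
  assumes "DIM('a) = 2" "\<not> collinear {A, B, C}"
  shows "frontier (convex hull {A, B, C}) = closed_segment A B \<union> closed_segment B C \<union> closed_segment C A"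
proof -
  have ne: "A \<noteq> B" "A \<noteq> C" "B \<noteq> C" and ind: "\<not> affine_dependent {A, B, C}"
    using assms(2) by (auto simp: collinear_3_eq_affine_dependent)
  have *: "{A, B, C} - {A} = {B, C}" "{A, B, C} - {B} = {C, A}" "{A, B, C} - {C} = {A, B}"
    using ne by auto
  have "{convex hull ({A, B, C} - {x}) |x. x \<in> {A, B, C}} =
      (\<lambda>x. convex hull ({A, B, C} - {x})) ` {A, B, C}" by blast
  also have "\<dots> = {closed_segment B C, closed_segment C A, closed_segment A B}"
    unfolding image_insert image_empty * segment_convex_hull[symmetric] ..
  finally show ?thesis
    using ne assms(1) frontier_convex_hull_cases[OF ind] by (simp add: Un_ac)
qed

text \<open>By invariance of domain the inverse maps interior points of \<open>T\<close> to interior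
  points of \<open>S\<close>, so no frontier point of \<open>S\<close> can land in the interior of
  \<open>T\<close>.\<close>

lemma homeomorphism_frontier_subset:
  fixes f :: "'a::euclidean_space \<Rightarrow> 'a"
  assumes hom: "homeomorphism S T f g" and "closed S" "closed T"
  shows "f ` frontier S \<subseteq> frontier T"
proof clarify
  fix x assume x: "x \<in> frontier S"
  with \<open>closed S\<close> have xS: "x \<in> S" by (simp add: frontier_def)
  then have "f x \<in> T" "g (f x) = x" using hom by (auto simp: homeomorphism_def)
  moreover have "g \<in> interior T \<rightarrow> interior (g ` T)"
    using hom by (intro continuous_image_subset_interior)
      (auto simp: homeomorphism_def intro: inj_on_inverseI)
  moreover have "g ` T = S" using hom by (simp add: homeomorphism_def)
  ultimately have "x \<in> interior S" if "f x \<in> interior T"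
    using that by (metis funcset_mem)
  then show "f x \<in> frontier T"
    using x \<open>f x \<in> T\<close> closure_subset[of T] by (auto simp: frontier_def)
qed

text \<open>Connectedness is applied to the splittings \<open>K\<close> against
  \<open>L \<union> N\<close> and \<open>L\<close> against \<open>K \<union> N\<close>.\<close>

lemma connected_subset_disjoint_closed_3:
  assumes "connected S" "closed K" "closed L" "closed N" "S \<subseteq> K \<union> L \<union> N"
    and "K \<inter> L \<inter> S = {}" "L \<inter> N \<inter> S = {}" "N \<inter> K \<inter> S = {}"
  shows "S \<subseteq> K \<or> S \<subseteq> L \<or> S \<subseteq> N"
proof -
  have "K \<inter> S = {} \<or> (L \<union> N) \<inter> S = {}"
    using assms by (intro connected_closedD) auto
  moreover have "L \<inter> S = {} \<or> (K \<union> N) \<inter> S = {}"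
    using assms by (intro connected_closedD) auto
  ultimately show ?thesis using assms(5) by blast
qed

text \<open>The image of the open edge is connected, lies in the frontier and avoids the three
  vertices, so it stays in one edge. Taking the closure adds \<open>B'\<close> and
  \<open>C'\<close>, which singles out that edge.\<close>

lemma homeomorphism_triangle_edge:
  fixes f :: "'a::euclidean_space \<Rightarrow> 'a"
  assumes dim: "DIM('a) = 2" and nc: "\<not> collinear {A, B, C}" and nc': "\<not> collinear {A', B', C'}"
    and hom: "homeomorphism (convex hull {A, B, C}) (convex hull {A', B', C'}) f g"
    and f: "f A = A'" "f B = B'" "f C = C'"
  shows "f ` closed_segment B C \<subseteq> closed_segment B' C'"
proof -
  let ?T = "convex hull {A, B, C}"
  have inj: "inj_on f ?T" and cont: "continuous_on ?T f"
    using hom by (auto simp: homeomorphism_def intro: inj_on_inverseI)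
  have vert: "A \<in> ?T" "B \<in> ?T" "C \<in> ?T" by (auto intro: hull_inc)
  have "A \<notin> closed_segment B C"
    using nc by (auto simp: between_mem_segment[symmetric] insert_commute dest: between_imp_collinear)
  then have A: "A \<notin> open_segment B C" using open_closed_segment by blast
  have BC: "B \<noteq> C" using nc by auto
  have seg: "closed_segment B C \<subseteq> ?T" by (simp add: vert closed_segment_subset)
  have o: "open_segment B C \<subseteq> closed_segment B C" by (auto simp: open_segment_def)
  define S where "S = f ` open_segment B C"
  have "connected S"
    unfolding S_def by (intro connected_continuous_image continuous_on_subset[OF cont] convex_connected)
      (use o seg in auto)
  have cl: "closed ?T" "closed (convex hull {A', B', C'})"
    by (auto intro!: compact_imp_closed finite_imp_compact_convex_hull)
  have "open_segment B C \<subseteq> frontier ?T"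
    using o unfolding frontier_triangle[OF dim nc] by blast
  then have S: "S \<subseteq> closed_segment A' B' \<union> closed_segment B' C' \<union> closed_segment C' A'"
    using homeomorphism_frontier_subset[OF hom cl] unfolding S_def frontier_triangle[OF dim nc'] by blast
  have "f w \<notin> S" if "w \<in> ?T" "w \<notin> open_segment B C" for w
    unfolding S_def using inj_on_image_mem_iff[OF inj that(1)] o seg that(2) by blast
  \<comment> \<open>By injectivity: no vertex lies on the open edge, so no image vertex lies in
    \<open>S\<close>.\<close>
  from this[OF vert(1) A] this[OF vert(2)] this[OF vert(3)]
  have avoid: "A' \<notin> S" "B' \<notin> S" "C' \<notin> S"
    unfolding f by (simp_all add: open_segment_def)
  have "closed_segment A' B' \<inter> closed_segment B' C' = {B'}"
    "closed_segment B' C' \<inter> closed_segment C' A' = {C'}"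
    "closed_segment C' A' \<inter> closed_segment A' B' = {A'}"
    using nc' by (auto intro!: Int_closed_segment simp: insert_commute)
  then have cases: "S \<subseteq> closed_segment A' B' \<or> S \<subseteq> closed_segment B' C' \<or> S \<subseteq> closed_segment C' A'"
    using avoid S \<open>connected S\<close> by (intro connected_subset_disjoint_closed_3) auto
  have ext: "f ` closed_segment B C \<subseteq> K" if "S \<subseteq> K" "closed K" for K
    using image_closure_subset[of "open_segment B C" f K] that BC seg continuous_on_subset[OF cont]
    by (simp add: S_def)
  have "C' \<notin> closed_segment A' B'" "B' \<notin> closed_segment C' A'"
    using nc' by (auto simp: between_mem_segment[symmetric] insert_commute dest: between_imp_collinear)
  moreover have "C' \<in> f ` closed_segment B C" "B' \<in> f ` closed_segment B C"
    unfolding f[symmetric] by simp_all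
  ultimately have "\<not> S \<subseteq> closed_segment A' B'" "\<not> S \<subseteq> closed_segment C' A'"
    using ext[of "closed_segment A' B'"] ext[of "closed_segment C' A'"] by auto
  then show ?thesis using cases ext by simp
qed

section \<open>The altitude as distance to the opposite edge\<close>

text \<open>The component of \<open>A - q\<close> along the unit normal \<open>n\<close> is
  \<open>h\<close> for every \<open>q\<close> on the base.\<close>

lemma altitude_le_dist:
  assumes fr: "altitude_frame A B C D u n a b h" and q: "q \<in> closed_segment B C"
  shows "h \<le> dist A q"
proof -
  obtain t where "q = (1 - t) *\<^sub>R B + t *\<^sub>R C" using q by (auto simp: in_segment)
  moreover have "A = D + h *\<^sub>R n" "B = D - a *\<^sub>R u" "C = D + b *\<^sub>R u"
    using fr by (simp_all add: altitude_frame_def)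
  ultimately have "A - q = h *\<^sub>R n + (a - t * (a + b)) *\<^sub>R u"
    by (simp only:) (simp add: algebra_simps)
  then have "(A - q) \<bullet> n = (h *\<^sub>R n + (a - t * (a + b)) *\<^sub>R u) \<bullet> n" by (simp only:)
  also have "\<dots> = h" using fr by (simp add: altitude_frame_def inner_add_left)
  finally have "(A - q) \<bullet> n = h" .
  moreover have "(A - q) \<bullet> n \<le> norm (A - q) * norm n" by (rule norm_cauchy_schwarz)
  moreover have "norm n = 1" using fr by (simp add: altitude_frame_def norm_eq_1)
  ultimately show ?thesis by (simp add: dist_norm)
qed

lemma altitude_frame_foot:
  assumes fr: "altitude_frame A B C D u n a b h"
  shows "D \<in> closed_segment B C" "dist A D = h" "orthogonal (A - D) (C - B)"
proof -
  have pos: "0 < a" "0 < b" "0 < h" using fr by (simp_all add: altitude_frame_def)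
  have "D = (1 - a / (a + b)) *\<^sub>R B + (a / (a + b)) *\<^sub>R C"
  proof -
    have "(a / (a + b)) *\<^sub>R (C - B) = a *\<^sub>R u"
    proof -
      have "C - B = (a + b) *\<^sub>R u" using fr by (simp add: altitude_frame_def algebra_simps)
      then show ?thesis using pos by simp
    qed
    then have "B + (a / (a + b)) *\<^sub>R (C - B) = D" using fr by (simp add: altitude_frame_def)
    then show ?thesis by (simp add: algebra_simps)
  qed
  then show "D \<in> closed_segment B C"
    unfolding in_segment using pos by (intro exI[of _ "a / (a + b)"]) auto
  have "norm n = 1" using fr by (simp add: altitude_frame_def norm_eq_1)
  then show "dist A D = h" using fr pos by (simp add: altitude_frame_def dist_norm)
  have "A - D = h *\<^sub>R n" "C - B = (a + b) *\<^sub>R u" "n \<bullet> u = 0"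
    using fr by (simp_all add: altitude_frame_def algebra_simps inner_commute)
  then show "orthogonal (A - D) (C - B)" by (simp add: orthogonal_def)
qed

subsection \<open>Labeled acute triangles\<close>

lemma labels_cyclic: "(j::3) = i \<or> j = i + 1 \<or> j = i + 2"
  using exhaust_3[of i] exhaust_3[of j] by auto

lemma vertices_cyclic: "{v (i::3), v (i + 1), v (i + 2)} = {v 1, v 2, v 3}"
proof -
  have "UNIV = {i, i + 1, i + 2}" using labels_cyclic[of _ i] by blast
  then have "{v i, v (i + 1), v (i + 2)} = range v" by auto
  then show ?thesis by (simp add: UNIV_3)
qed

lemma filled_triangle_cyclic: "filled_triangle v = convex hull {v i, v (i + 1), v (i + 2)}"
  by (simp add: filled_triangle_def vertices_cyclic)

lemma label_shift: "(i::3) + 1 + 1 = i + 2" "i + 1 + 2 = i" "i + 2 + 1 = i" "i + 2 + 2 = i + 1"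
  using exhaust_3[of i] by auto

lemma labeled_triangle_not_collinear:
  "labeled_triangle v \<Longrightarrow> \<not> collinear {v i, v (i + 1), v (i + 2)}"
  by (simp add: vertices_cyclic labeled_triangle_def)

lemma labeled_triangle_inj:
  assumes "labeled_triangle v" shows "v i \<noteq> v (i + 1)" "v (i + 1) \<noteq> v (i + 2)" "v i \<noteq> v (i + 2)"
  using labeled_triangle_not_collinear[OF assms, of i] by (auto simp: insert_commute)

lemma acute_inner_pos:
  assumes "labeled_triangle v" "acute v"
  shows "0 < (v (i + 1) - v i) \<bullet> (v (i + 2) - v i)"
proof -
  let ?a = "v (i + 1) - v i" and ?b = "v (i + 2) - v i"
  let ?c = "(?a \<bullet> ?b) / (norm ?a * norm ?b)"
  have n: "0 < norm ?a * norm ?b" using labeled_triangle_inj[OF assms(1), of i] by simp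
  \<comment> \<open>This bound ensures that \<open>arccos\<close> really inverts \<open>cos\<close>
    at the quotient.\<close>
  have "\<bar>?c\<bar> \<le> 1" using Cauchy_Schwarz_ineq2[of ?a ?b] n by (simp add: abs_mult)
  then have c: "-1 \<le> ?c" "?c \<le> 1" by linarith+
  have "arccos ?c < pi / 2" using assms(2) by (simp add: acute_def vertex_angle_def)
  moreover have "0 \<le> arccos ?c" using arccos_lbound c by blast
  ultimately have "0 < cos (arccos ?c)" by (intro cos_gt_zero_pi) auto
  then have "0 < ?c" using c by simp
  then show ?thesis using n by (simp add: zero_less_divide_iff)
qed

lemma acute_inner_pos_all:
  assumes "labeled_triangle v" "acute v"
  shows "0 < (v (i + 1) - v i) \<bullet> (v (i + 2) - v i)"
    "0 < (v i - v (i + 1)) \<bullet> (v (i + 2) - v (i + 1))"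
    "0 < (v i - v (i + 2)) \<bullet> (v (i + 1) - v (i + 2))"
  using acute_inner_pos[OF assms, of i] acute_inner_pos[OF assms, of "i + 1"]
    acute_inner_pos[OF assms, of "i + 2"]
  by (simp_all add: label_shift inner_commute)

text \<open>The frame supplies a point with the defining property of \<open>altitude_foot\<close>;
  uniqueness of the foot identifies the two.\<close>

lemma acute_altitude_frame:
  assumes "labeled_triangle v" "acute v"
  obtains u n a b h where "altitude_frame (v i) (v (i + 1)) (v (i + 2)) (altitude_foot v i) u n a b h"
    "altitude_length v i = h"
proof -
  obtain D u n a b h where fr: "altitude_frame (v i) (v (i + 1)) (v (i + 2)) D u n a b h"
    using altitude_frame_exists[OF gram_pos[OF labeled_triangle_not_collinear[OF assms(1), of i]]]
      acute_inner_pos_all[OF assms, of i] by blast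
  have "D \<in> affine hull {v (i + 1), v (i + 2)}"
    using altitude_frame_foot(1)[OF fr] convex_hull_subset_affine_hull by (auto simp: segment_convex_hull)
  then have "altitude_foot v i = D"
    unfolding altitude_foot_def
    by (intro the1_equality altitude_foot_unique[OF assms(1)]) (use altitude_frame_foot(3)[OF fr] in simp)
  moreover from this have "altitude_length v i = h"
    using altitude_frame_foot(2)[OF fr] by (simp add: altitude_length_def)
  ultimately show ?thesis using fr that by blast
qed

lemma altitude_length_eq:
  assumes "labeled_triangle v" "acute v"
  shows "altitude_length v i = altitude (v i) (v (i + 1)) (v (i + 2))"
  using acute_altitude_frame[OF assms, of i] altitude_frame_altitude by metis

lemma altitude_length_pos:
  assumes "labeled_triangle v" "acute v"
  shows "0 < altitude_length v i"
  using acute_altitude_frame[OF assms, of i] unfolding altitude_frame_def by metis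

lemma edge_length_pos: "labeled_triangle v \<Longrightarrow> 0 < edge_length v i"
  by (simp add: edge_length_def labeled_triangle_inj)

section \<open>Lower bound by the six ratios\<close>

lemma lipschitz_constant_ge:
  assumes "x \<in> T" "y \<in> T" "x \<noteq> y" "c \<le> dist (f x) (f y)"
  shows "ereal (c / dist x y) \<le> lipschitz_constant T f"
  unfolding lipschitz_constant_def
  by (rule SUP_upper2[of "(x, y)"]) (use assms in \<open>auto intro: divide_right_mono\<close>)

lemma lipschitz_constant_le:
  assumes "M-lipschitz_on T f"
  shows "lipschitz_constant T f \<le> ereal M"
  unfolding lipschitz_constant_def
  by (rule SUP_least) (use lipschitz_onD[OF assms] in \<open>auto simp: divide_le_eq\<close>)

definition ratios :: "vertices \<Rightarrow> vertices \<Rightarrow> real set" where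
  "ratios v v' = range (\<lambda>i. edge_length v' i / edge_length v i) \<union>
     range (\<lambda>i. altitude_length v' i / altitude_length v i)"

text \<open>Each ratio has a test pair: the endpoints of the edge, or the vertex and the foot of its
  altitude.\<close>

lemma ratio_le_lipschitz_constant:
  assumes "labeled_triangle v" "acute v" "labeled_triangle v'" "acute v'"
    and f: "label_preserving_homeo v v' f" and r: "r \<in> ratios v v'"
  shows "ereal r \<le> lipschitz_constant (filled_triangle v) f"
proof -
  obtain g where hom: "homeomorphism (filled_triangle v) (filled_triangle v') f g"
    and fv: "\<And>i. f (v i) = v' i"
    using f by (auto simp: label_preserving_homeo_def)
  have vert: "v i \<in> filled_triangle v" for i
    unfolding filled_triangle_cyclic[of v i] by (auto intro: hull_inc)
  consider i where "r = edge_length v' i / edge_length v i"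
    | i where "r = altitude_length v' i / altitude_length v i"
    using r by (auto simp: ratios_def)
  then show ?thesis
  proof cases
    case 1
    then show ?thesis
      using lipschitz_constant_ge[OF vert[of "i + 1"] vert[of "i + 2"], of "edge_length v' i" f]
        labeled_triangle_inj[OF assms(1)] by (simp add: edge_length_def fv)
  next
    case 2
    let ?p = "altitude_foot v i"
    obtain u n a b h where fr: "altitude_frame (v i) (v (i + 1)) (v (i + 2)) ?p u n a b h"
      using acute_altitude_frame[OF assms(1,2)] by metis
    obtain u' n' a' b' where fr': "altitude_frame (v' i) (v' (i + 1)) (v' (i + 2)) (altitude_foot v' i)
        u' n' a' b' (altitude_length v' i)"
      using acute_altitude_frame[OF assms(3,4)] by metis
    have p: "?p \<in> closed_segment (v (i + 1)) (v (i + 2))" by (rule altitude_frame_foot(1)[OF fr])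
    have "f ` closed_segment (v (i + 1)) (v (i + 2)) \<subseteq> closed_segment (v' (i + 1)) (v' (i + 2))"
      by (rule homeomorphism_triangle_edge[where A = "v i" and A' = "v' i" and g = g])
        (use hom fv labeled_triangle_not_collinear assms in \<open>auto simp: filled_triangle_cyclic[of _ i]\<close>)
    \<comment> \<open>The image of the foot need not be the foot in the target, but it lies on the
      opposite edge.\<close>
    then have "altitude_length v' i \<le> dist (f (v i)) (f ?p)"
      unfolding fv using p by (intro altitude_le_dist[OF fr']) auto
    moreover have "?p \<in> filled_triangle v"
      using p closed_segment_subset[OF vert[of "i + 1"] vert[of "i + 2"]]
      by (auto simp: filled_triangle_def)
    moreover have "v i \<noteq> ?p"
      using altitude_length_pos[OF assms(1,2), of i] by (auto simp: altitude_length_def)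
    ultimately show ?thesis
      unfolding 2 altitude_length_def[of v] by (intro lipschitz_constant_ge vert)
  qed
qed

section \<open>The optimal map\<close>

lemma lipschitz_homeo_label_preserving:
  assumes "lipschitz_homeo M (v i) (v (i + 1)) (v (i + 2)) (v' i) (v' (i + 1)) (v' (i + 2))"
  obtains f where "label_preserving_homeo v v' f" "M-lipschitz_on (filled_triangle v) f"
proof -
  obtain f g where f: "homeomorphism (filled_triangle v) (filled_triangle v') f g"
    "f (v i) = v' i" "f (v (i + 1)) = v' (i + 1)" "f (v (i + 2)) = v' (i + 2)"
    "M-lipschitz_on (filled_triangle v) f"
    using assms unfolding lipschitz_homeo_def filled_triangle_cyclic[of _ i] by blast
  have "f (v j) = v' j" for j using labels_cyclic[of j i] f(2-4) by auto
  then show ?thesis using f that by (auto simp: label_preserving_homeo_def)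
qed

text \<open>The ratio attaining the maximum selects the construction and gives its equality; the
  other ratios give the inequalities it needs.\<close>

lemma optimal_homeo_exists:
  assumes "labeled_triangle v" "acute v" "labeled_triangle v'" "acute v'"
  obtains f where "label_preserving_homeo v v' f" "(Max (ratios v v'))-lipschitz_on (filled_triangle v) f"
proof -
  define M where "M = Max (ratios v v')"
  have fin: "finite (ratios v v')" by (simp add: ratios_def)
  have le: "r \<le> M" if "r \<in> ratios v v'" for r using fin that by (simp add: M_def)
  have edge: "edge_length v' i \<le> M * edge_length v i" for i
    using le[of "edge_length v' i / edge_length v i"] edge_length_pos[OF assms(1), of i]
    by (auto simp: ratios_def divide_le_eq)
  have alt: "altitude_length v' i \<le> M * altitude_length v i" for i
    using le[of "altitude_length v' i / altitude_length v i"] altitude_length_pos[OF assms(1,2), of i]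
    by (auto simp: ratios_def divide_le_eq)
  have gram: "0 < gram (v i) (v (i + 1)) (v (i + 2))" "0 < gram (v' i) (v' (i + 1)) (v' (i + 2))" for i
    using assms by (simp_all add: gram_pos labeled_triangle_not_collinear)
  note acute = acute_inner_pos_all[OF assms(1,2)] and acute' = acute_inner_pos_all[OF assms(3,4)]
  have "M \<in> ratios v v'" unfolding M_def using fin by (intro Max_in) (auto simp: ratios_def)
  then consider i where "M = altitude_length v' i / altitude_length v i"
    | i where "M = edge_length v' i / edge_length v i"
    unfolding ratios_def by blast
  then obtain i where "lipschitz_homeo M (v i) (v (i + 1)) (v (i + 2)) (v' i) (v' (i + 1)) (v' (i + 2))"
  proof cases
    case 1
    then have "altitude_length v' i = M * altitude_length v i"
      using altitude_length_pos[OF assms(1,2), of i] by simp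
    then have "lipschitz_homeo M (v i) (v (i + 1)) (v (i + 2)) (v' i) (v' (i + 1)) (v' (i + 2))"
      \<comment> \<open>Edges \<open>i + 1\<close> and \<open>i + 2\<close> are the two sides
        meeting at vertex \<open>i\<close>.\<close>
      using edge[of "i + 1"] edge[of "i + 2"]
      by (intro lipschitz_homeo_altitude gram acute acute')
        (simp_all add: altitude_length_eq assms edge_length_def label_shift dist_commute)
    then show ?thesis by (rule that)
  next
    case 2
    then have "edge_length v' i = M * edge_length v i"
      using edge_length_pos[OF assms(1), of i] by simp
    then have "lipschitz_homeo M (v i) (v (i + 1)) (v (i + 2)) (v' i) (v' (i + 1)) (v' (i + 2))"
      \<comment> \<open>These are the altitudes from the two endpoints of edge
        \<open>i\<close>.\<close>
      using alt[of "i + 1"] alt[of "i + 2"]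
      by (intro lipschitz_homeo_edge gram acute acute')
        (simp_all add: altitude_length_eq assms edge_length_def label_shift)
    then show ?thesis by (rule that)
  qed
  then show ?thesis using lipschitz_homeo_label_preserving that unfolding M_def by metis
qed

theorem theorem1:
  fixes v v' :: vertices
  assumes "labeled_triangle v" and "acute v"
    and "labeled_triangle v'" and "acute v'"
  shows "L_dist v v' = ereal (m_dist v v') \<and>
    (\<exists>f. label_preserving_homeo v v' f \<and>
         lipschitz_constant (filled_triangle v) f = ereal (exp (real_of_ereal (L_dist v v'))))"
proof -
  define M where "M = Max (ratios v v')"
  obtain f where f: "label_preserving_homeo v v' f" "M-lipschitz_on (filled_triangle v) f"
    using optimal_homeo_exists[OF assms] unfolding M_def by blast
  have fin: "finite (ratios v v')" by (simp add: ratios_def)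
  then have M_in: "M \<in> ratios v v'" unfolding M_def by (intro Max_in) (auto simp: ratios_def)
  \<comment> \<open>Positivity selects the logarithmic branch of \<open>ereal_ln\<close> and lets
    \<open>exp\<close> undo \<open>ln\<close>.\<close>
  then have "0 < M"
    using edge_length_pos altitude_length_pos assms by (auto simp: ratios_def)
  have lower: "ereal M \<le> lipschitz_constant (filled_triangle v) f'"
    if "label_preserving_homeo v v' f'" for f'
    using ratio_le_lipschitz_constant[OF assms that M_in] .
  have eq: "lipschitz_constant (filled_triangle v) f = ereal M"
    using lower[OF f(1)] lipschitz_constant_le[OF f(2)] by (rule antisym[rotated])
  \<comment> \<open>The infimum is attained at \<open>f\<close>, whose constant equals the common
    lower bound \<open>M\<close>.\<close>
  have "(INF f \<in> {f. label_preserving_homeo v v' f}. lipschitz_constant (filled_triangle v) f) = ereal M"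
    by (rule antisym) (use f(1) eq lower in \<open>auto intro: INF_lower2 INF_greatest\<close>)
  then have "L_dist v v' = ereal (ln M)"
    using \<open>0 < M\<close> by (simp add: L_dist_def ereal_ln_def)
  moreover have "m_dist v v' = ln M" by (simp add: m_dist_def M_def ratios_def)
  ultimately show ?thesis using f(1) eq \<open>0 < M\<close> by auto
qed

end
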